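(* Let $\mathfrak g$ be a nilpotent Lie algebra with a pseudo-Riemannian metric $g$, $D$ a derivation of $\mathfrak g$ and $\tau=\pm1$. Assume $\tilde{\mathfrak g}=\mathfrak g\rtimes_D\mathrm{Span}\{e_0\}$ has a $\mathfrak z$-standard Sasaki structure $(\phi,\xi,\eta,\tilde g)$ (with respect to this decomposition: $\tilde g=g+\tau e^0\otimes e^0$ and $b=-\phi(e_0)$ lies in the center of $\mathfrak g$). Then $\xi$ is central in $\mathfrak g$ and there is $h\in\mathbb R$ such that 1. $g(\xi,\xi)=1$, $g(b,b)=\tau$, $g(b,\xi)=0$; 2. the quotient $\check{\mathfrak g}=\mathfrak g/\mathrm{Span}\{b,\xi\}$ has a pseudo-Kähler structure $(\check g,J,\omega)$ with $(\mathfrak g,g)\to(\check{\mathfrak g},\check g)$ a Riemannian submersion, $\omega=\frac12 d\eta$ and $\check D(\omega)=db^\flat$; 3. relative to the splitting $\mathrm{Span}\{b,\xi\}^\perp\oplus\mathrm{Span}\{b\}\oplus\mathrm{Span}\{\xi\}$, $D$ takes the form $$D=\begin{pmatrix}\check D&0&0\\0&h&0\\0&-2\tau&0\end{pmatrix};$$ 4. $[J,\check D]=0$; 5. $\check D$ is a derivation and $[\check D^s,\check D^a]=h\check D^s-2(\check D^s)^2$.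
   Context: All structures are left-invariant and are described on a real finite-dimensional Lie algebra; a (pseudo-Riemannian) metric on a Lie algebra is a nondegenerate symmetric bilinear form of arbitrary signature. $\tilde{\mathfrak g}=\mathfrak g\rtimes_D\mathrm{Span}\{e_0\}$ is $\mathfrak g\oplus\mathbb R e_0$ with $[e_0,v]=Dv$ for $v\in\mathfrak g$; $e^0$ is the $1$-form with $e^0(e_0)=1$, $e^0|_{\mathfrak g}=0$, and $g$ is extended by zero on $e_0$. In the conclusions $d$, ${}^\flat$ refer to $(\mathfrak g,g)$: $x^\flat=g(x,\cdot)$, $d\alpha(x,y)=-\alpha([x,y])$ for $1$-forms; $\eta$ is restricted to $\mathfrak g$, and forms on $\check{\mathfrak g}$ are identified with their pullbacks to $\mathfrak g$. For an endomorphism $f$ of a metric vector space, $f^*$ is the metric adjoint, $f^s=\frac12(f+f^* )$, $f^a=\frac12(f-f^* )$; $f$ acts on $2$-forms by $(f\beta)(u,w)=-\beta(fu,w)-\beta(u,fw)$. $\check D$ is the endomorphism of $\mathrm{Span}\{b,\xi\}^\perp$ (orthogonal complement in $\mathfrak g$) appearing in item 3, regarded as an endomorphism of $\check{\mathfrak g}$ through the identification $\mathrm{Span}\{b,\xi\}^\perp\cong\check{\mathfrak g}$; $\check D^s,\check D^a$ are taken with respect to $\check g$. Riemannian submersion means that this identification is an isometry of $g|_{\mathrm{Span}\{b,\xi\}^\perp}$ with $\check g$. An almost contact metric structure on a Lie algebra of dimension $2n+1$ is $(\phi,\xi,\eta,\tilde g)$ with $\phi$ an endomorphism, $\xi$ a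 vector, $\eta$ a $1$-form and $\tilde g$ a metric such that $\eta(\xi)=1$, $\eta\circ\phi=0$, $\phi^2=-\mathrm{Id}+\eta\otimes\xi$, $\tilde g(\xi,\xi)=1$, $\eta=\tilde g(\xi,\cdot)$, $\tilde g(\phi x,\phi y)=\tilde g(x,y)-\eta(x)\eta(y)$. Its fundamental form is $\Phi=\tilde g(\cdot,\phi\,\cdot)$. It is Sasaki if $d\eta=2\Phi$ and $N_\phi+d\eta\otimes\xi=0$, where $N_\phi(x,y)=\phi^2[x,y]+[\phi x,\phi y]-\phi[\phi x,y]-\phi[x,\phi y]$. A pseudo-Kähler structure on a Lie algebra is $(\check g,J,\omega)$ with $\check g$ a pseudo-Riemannian metric, $J$ an integrable complex structure which is orthogonal for $\check g$, and $\omega=\check g(\cdot,J\,\cdot)$ a closed $2$-form. *)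

theory Defs
  imports "HOL-Analysis.Analysis"
begin

text \<open>
  A real Lie algebra \<open>\<gg>\<close> is given by a bracket on a type of class \<open>real_vector\<close>, but the quotient
  of \<open>\<gg>\<close> by an ideal is a set of cosets and has no type of its own. Hence the notions below are
  formulated for structures with an explicit carrier; \<open>lie_of\<close> views a bracket on a type as such a
  structure. Maps and forms are only relevant on the carrier.
\<close>

record 'a lie_struct =
  carrier :: "'a set"
  vzero :: "'a"  ("\<zero>\<index>")
  vadd :: "'a \<Rightarrow> 'a \<Rightarrow> 'a"  (infixl "\<oplus>\<index>" 65)
  vscale :: "real \<Rightarrow> 'a \<Rightarrow> 'a"  (infixr "\<odot>\<index>" 75)
  brac :: "'a \<Rightarrow> 'a \<Rightarrow> 'a"

definition vdiff :: "('a, 'm) lie_struct_scheme \<Rightarrow> 'a \<Rightarrow> 'a \<Rightarrow> 'a"  (infixl "\<ominus>\<index>" 65) where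
  "x \<ominus>\<^bsub>L\<^esub> y = x \<oplus>\<^bsub>L\<^esub> (-1) \<odot>\<^bsub>L\<^esub> y"

definition real_vector_struct :: "('a, 'm) lie_struct_scheme \<Rightarrow> bool" where
  "real_vector_struct L \<longleftrightarrow>
     \<zero>\<^bsub>L\<^esub> \<in> carrier L \<and>
     (\<forall>x\<in>carrier L. \<forall>y\<in>carrier L. x \<oplus>\<^bsub>L\<^esub> y \<in> carrier L \<and> x \<oplus>\<^bsub>L\<^esub> y = y \<oplus>\<^bsub>L\<^esub> x) \<and>
     (\<forall>x\<in>carrier L. \<forall>y\<in>carrier L. \<forall>z\<in>carrier L.
        (x \<oplus>\<^bsub>L\<^esub> y) \<oplus>\<^bsub>L\<^esub> z = x \<oplus>\<^bsub>L\<^esub> (y \<oplus>\<^bsub>L\<^esub> z)) \<and>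
     (\<forall>x\<in>carrier L. \<zero>\<^bsub>L\<^esub> \<oplus>\<^bsub>L\<^esub> x = x \<and> x \<oplus>\<^bsub>L\<^esub> (-1) \<odot>\<^bsub>L\<^esub> x = \<zero>\<^bsub>L\<^esub> \<and> 1 \<odot>\<^bsub>L\<^esub> x = x) \<and>
     (\<forall>c. \<forall>x\<in>carrier L. c \<odot>\<^bsub>L\<^esub> x \<in> carrier L) \<and>
     (\<forall>c d. \<forall>x\<in>carrier L. (c * d) \<odot>\<^bsub>L\<^esub> x = c \<odot>\<^bsub>L\<^esub> d \<odot>\<^bsub>L\<^esub> x \<and>
        (c + d) \<odot>\<^bsub>L\<^esub> x = c \<odot>\<^bsub>L\<^esub> x \<oplus>\<^bsub>L\<^esub> d \<odot>\<^bsub>L\<^esub> x) \<and>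
     (\<forall>c. \<forall>x\<in>carrier L. \<forall>y\<in>carrier L. c \<odot>\<^bsub>L\<^esub> (x \<oplus>\<^bsub>L\<^esub> y) = c \<odot>\<^bsub>L\<^esub> x \<oplus>\<^bsub>L\<^esub> c \<odot>\<^bsub>L\<^esub> y)"

definition linear_map ::
    "('a, 'm) lie_struct_scheme \<Rightarrow> ('b, 'n) lie_struct_scheme \<Rightarrow> ('a \<Rightarrow> 'b) \<Rightarrow> bool" where
  "linear_map L M f \<longleftrightarrow>
     (\<forall>x\<in>carrier L. f x \<in> carrier M) \<and>
     (\<forall>x\<in>carrier L. \<forall>y\<in>carrier L. f (x \<oplus>\<^bsub>L\<^esub> y) = f x \<oplus>\<^bsub>M\<^esub> f y) \<and>
     (\<forall>c. \<forall>x\<in>carrier L. f (c \<odot>\<^bsub>L\<^esub> x) = c \<odot>\<^bsub>M\<^esub> f x)"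

abbreviation endomorphism :: "('a, 'm) lie_struct_scheme \<Rightarrow> ('a \<Rightarrow> 'a) \<Rightarrow> bool" where
  "endomorphism L f \<equiv> linear_map L L f"

definition lie_algebra :: "('a, 'm) lie_struct_scheme \<Rightarrow> bool" where
  "lie_algebra L \<longleftrightarrow>
     real_vector_struct L \<and>
     (\<forall>x\<in>carrier L. endomorphism L (\<lambda>y. brac L x y)) \<and>
     (\<forall>y\<in>carrier L. endomorphism L (\<lambda>x. brac L x y)) \<and>
     (\<forall>x\<in>carrier L. brac L x x = \<zero>\<^bsub>L\<^esub>) \<and>
     (\<forall>x\<in>carrier L. \<forall>y\<in>carrier L. \<forall>z\<in>carrier L.
        brac L x (brac L y z) \<oplus>\<^bsub>L\<^esub> brac L y (brac L z x) \<oplus>\<^bsub>L\<^esub> brac L z (brac L x y) = \<zero>\<^bsub>L\<^esub>)"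

definition lie_hom ::
    "('a, 'm) lie_struct_scheme \<Rightarrow> ('b, 'n) lie_struct_scheme \<Rightarrow> ('a \<Rightarrow> 'b) \<Rightarrow> bool" where
  "lie_hom L M f \<longleftrightarrow> linear_map L M f \<and>
     (\<forall>x\<in>carrier L. \<forall>y\<in>carrier L. f (brac L x y) = brac M (f x) (f y))"

definition center :: "('a, 'm) lie_struct_scheme \<Rightarrow> 'a set" where
  "center L = {z \<in> carrier L. \<forall>x\<in>carrier L. brac L z x = \<zero>\<^bsub>L\<^esub>}"

definition derivation :: "('a, 'm) lie_struct_scheme \<Rightarrow> ('a \<Rightarrow> 'a) \<Rightarrow> bool" where
  "derivation L D \<longleftrightarrow> endomorphism L D \<and>
     (\<forall>x\<in>carrier L. \<forall>y\<in>carrier L. D (brac L x y) = brac L (D x) y \<oplus>\<^bsub>L\<^esub> brac L x (D y))"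

definition linear_form :: "('a, 'm) lie_struct_scheme \<Rightarrow> ('a \<Rightarrow> real) \<Rightarrow> bool" where
  "linear_form L \<alpha> \<longleftrightarrow>
     (\<forall>x\<in>carrier L. \<forall>y\<in>carrier L. \<alpha> (x \<oplus>\<^bsub>L\<^esub> y) = \<alpha> x + \<alpha> y) \<and>
     (\<forall>c. \<forall>x\<in>carrier L. \<alpha> (c \<odot>\<^bsub>L\<^esub> x) = c * \<alpha> x)"

definition bilinear_form :: "('a, 'm) lie_struct_scheme \<Rightarrow> ('a \<Rightarrow> 'a \<Rightarrow> real) \<Rightarrow> bool" where
  "bilinear_form L \<beta> \<longleftrightarrow>
     (\<forall>x\<in>carrier L. linear_form L (\<lambda>y. \<beta> x y)) \<and> (\<forall>y\<in>carrier L. linear_form L (\<lambda>x. \<beta> x y))"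

definition two_form :: "('a, 'm) lie_struct_scheme \<Rightarrow> ('a \<Rightarrow> 'a \<Rightarrow> real) \<Rightarrow> bool" where
  "two_form L \<beta> \<longleftrightarrow> bilinear_form L \<beta> \<and> (\<forall>x\<in>carrier L. \<forall>y\<in>carrier L. \<beta> x y = - \<beta> y x)"

text \<open>Pseudo-Riemannian metrics; the signature is arbitrary.\<close>

definition pseudo_metric :: "('a, 'm) lie_struct_scheme \<Rightarrow> ('a \<Rightarrow> 'a \<Rightarrow> real) \<Rightarrow> bool" where
  "pseudo_metric L g \<longleftrightarrow> bilinear_form L g \<and>
     (\<forall>x\<in>carrier L. \<forall>y\<in>carrier L. g x y = g y x) \<and>
     (\<forall>x\<in>carrier L. (\<forall>y\<in>carrier L. g x y = 0) \<longrightarrow> x = \<zero>\<^bsub>L\<^esub>)"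

definition d1 :: "('a, 'm) lie_struct_scheme \<Rightarrow> ('a \<Rightarrow> real) \<Rightarrow> 'a \<Rightarrow> 'a \<Rightarrow> real" where
  "d1 L \<alpha> x y = - \<alpha> (brac L x y)"

definition d2 :: "('a, 'm) lie_struct_scheme \<Rightarrow> ('a \<Rightarrow> 'a \<Rightarrow> real) \<Rightarrow> 'a \<Rightarrow> 'a \<Rightarrow> 'a \<Rightarrow> real" where
  "d2 L \<beta> x y z = - \<beta> (brac L x y) z + \<beta> (brac L x z) y - \<beta> (brac L y z) x"

definition act2 :: "('a \<Rightarrow> 'a) \<Rightarrow> ('a \<Rightarrow> 'a \<Rightarrow> real) \<Rightarrow> 'a \<Rightarrow> 'a \<Rightarrow> real" where
  "act2 f \<beta> u w = - \<beta> (f u) w - \<beta> u (f w)"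

definition commutator ::
    "('a, 'm) lie_struct_scheme \<Rightarrow> ('a \<Rightarrow> 'a) \<Rightarrow> ('a \<Rightarrow> 'a) \<Rightarrow> 'a \<Rightarrow> 'a" where
  "commutator L f k x = f (k x) \<ominus>\<^bsub>L\<^esub> k (f x)"

text \<open>
  The metric adjoint, pointwise: on a finite-dimensional carrier with a metric, the vector described
  by \<open>THE\<close> exists and is unique for every endomorphism \<open>f\<close>.
\<close>

definition adj ::
    "('a, 'm) lie_struct_scheme \<Rightarrow> ('a \<Rightarrow> 'a \<Rightarrow> real) \<Rightarrow> ('a \<Rightarrow> 'a) \<Rightarrow> 'a \<Rightarrow> 'a" where
  "adj L g f y = (THE z. z \<in> carrier L \<and> (\<forall>x\<in>carrier L. g (f x) y = g x z))"

definition sym_part ::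
    "('a, 'm) lie_struct_scheme \<Rightarrow> ('a \<Rightarrow> 'a \<Rightarrow> real) \<Rightarrow> ('a \<Rightarrow> 'a) \<Rightarrow> 'a \<Rightarrow> 'a" where
  "sym_part L g f x = (1/2) \<odot>\<^bsub>L\<^esub> (f x \<oplus>\<^bsub>L\<^esub> adj L g f x)"

definition skew_part ::
    "('a, 'm) lie_struct_scheme \<Rightarrow> ('a \<Rightarrow> 'a \<Rightarrow> real) \<Rightarrow> ('a \<Rightarrow> 'a) \<Rightarrow> 'a \<Rightarrow> 'a" where
  "skew_part L g f x = (1/2) \<odot>\<^bsub>L\<^esub> (f x \<ominus>\<^bsub>L\<^esub> adj L g f x)"

definition orth_compl ::
    "('a, 'm) lie_struct_scheme \<Rightarrow> ('a \<Rightarrow> 'a \<Rightarrow> real) \<Rightarrow> 'a set \<Rightarrow> 'a set" where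
  "orth_compl L g S = {v \<in> carrier L. \<forall>s\<in>S. g v s = 0}"

definition riemannian_submersion ::
    "('a, 'm) lie_struct_scheme \<Rightarrow> ('a \<Rightarrow> 'a \<Rightarrow> real) \<Rightarrow> ('a \<Rightarrow> 'b) \<Rightarrow>
     ('b, 'n) lie_struct_scheme \<Rightarrow> ('b \<Rightarrow> 'b \<Rightarrow> real) \<Rightarrow> bool" where
  "riemannian_submersion L g p M g' \<longleftrightarrow>
     lie_hom L M p \<and>
     (let H = orth_compl L g {x \<in> carrier L. p x = \<zero>\<^bsub>M\<^esub>}
      in bij_betw p H (carrier M) \<and> (\<forall>v\<in>H. \<forall>w\<in>H. g' (p v) (p w) = g v w))"

definition nijenhuis :: "('a, 'm) lie_struct_scheme \<Rightarrow> ('a \<Rightarrow> 'a) \<Rightarrow> 'a \<Rightarrow> 'a \<Rightarrow> 'a" where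
  "nijenhuis L f x y =
     f (f (brac L x y)) \<oplus>\<^bsub>L\<^esub> brac L (f x) (f y) \<ominus>\<^bsub>L\<^esub> f (brac L (f x) y) \<ominus>\<^bsub>L\<^esub> f (brac L x (f y))"

definition almost_contact_metric ::
    "('a, 'm) lie_struct_scheme \<Rightarrow> ('a \<Rightarrow> 'a) \<Rightarrow> 'a \<Rightarrow> ('a \<Rightarrow> real) \<Rightarrow> ('a \<Rightarrow> 'a \<Rightarrow> real) \<Rightarrow> bool" where
  "almost_contact_metric L \<phi> \<xi> \<eta> g \<longleftrightarrow>
     lie_algebra L \<and> endomorphism L \<phi> \<and> \<xi> \<in> carrier L \<and> linear_form L \<eta> \<and> pseudo_metric L g \<and>
     \<eta> \<xi> = 1 \<and>
     (\<forall>x\<in>carrier L. \<eta> (\<phi> x) = 0) \<and>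
     (\<forall>x\<in>carrier L. \<phi> (\<phi> x) = (-1) \<odot>\<^bsub>L\<^esub> x \<oplus>\<^bsub>L\<^esub> \<eta> x \<odot>\<^bsub>L\<^esub> \<xi>) \<and>
     g \<xi> \<xi> = 1 \<and>
     (\<forall>x\<in>carrier L. \<eta> x = g \<xi> x) \<and>
     (\<forall>x\<in>carrier L. \<forall>y\<in>carrier L. g (\<phi> x) (\<phi> y) = g x y - \<eta> x * \<eta> y)"

definition fundamental_form :: "('a \<Rightarrow> 'a) \<Rightarrow> ('a \<Rightarrow> 'a \<Rightarrow> real) \<Rightarrow> 'a \<Rightarrow> 'a \<Rightarrow> real" where
  "fundamental_form \<phi> g x y = g x (\<phi> y)"

definition sasaki ::
    "('a, 'm) lie_struct_scheme \<Rightarrow> ('a \<Rightarrow> 'a) \<Rightarrow> 'a \<Rightarrow> ('a \<Rightarrow> real) \<Rightarrow> ('a \<Rightarrow> 'a \<Rightarrow> real) \<Rightarrow> bool" where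
  "sasaki L \<phi> \<xi> \<eta> g \<longleftrightarrow>
     almost_contact_metric L \<phi> \<xi> \<eta> g \<and>
     (\<forall>x\<in>carrier L. \<forall>y\<in>carrier L. d1 L \<eta> x y = 2 * fundamental_form \<phi> g x y) \<and>
     (\<forall>x\<in>carrier L. \<forall>y\<in>carrier L. nijenhuis L \<phi> x y \<oplus>\<^bsub>L\<^esub> d1 L \<eta> x y \<odot>\<^bsub>L\<^esub> \<xi> = \<zero>\<^bsub>L\<^esub>)"

definition pseudo_kaehler ::
    "('a, 'm) lie_struct_scheme \<Rightarrow> ('a \<Rightarrow> 'a \<Rightarrow> real) \<Rightarrow> ('a \<Rightarrow> 'a) \<Rightarrow> ('a \<Rightarrow> 'a \<Rightarrow> real) \<Rightarrow> bool" where
  "pseudo_kaehler L g J \<omega> \<longleftrightarrow>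
     lie_algebra L \<and> pseudo_metric L g \<and> endomorphism L J \<and>
     (\<forall>x\<in>carrier L. J (J x) = (-1) \<odot>\<^bsub>L\<^esub> x) \<and>
     (\<forall>x\<in>carrier L. \<forall>y\<in>carrier L. nijenhuis L J x y = \<zero>\<^bsub>L\<^esub>) \<and>
     (\<forall>x\<in>carrier L. \<forall>y\<in>carrier L. g (J x) (J y) = g x y) \<and>
     (\<forall>x\<in>carrier L. \<forall>y\<in>carrier L. \<omega> x y = g x (J y)) \<and>
     two_form L \<omega> \<and>
     (\<forall>x\<in>carrier L. \<forall>y\<in>carrier L. \<forall>z\<in>carrier L. d2 L \<omega> x y z = 0)"

definition lie_of :: "('a::real_vector \<Rightarrow> 'a \<Rightarrow> 'a) \<Rightarrow> 'a lie_struct" where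
  "lie_of br = \<lparr>carrier = UNIV, vzero = 0, vadd = (+), vscale = (*\<^sub>R), brac = br\<rparr>"

fun lower_central :: "('a::real_vector \<Rightarrow> 'a \<Rightarrow> 'a) \<Rightarrow> nat \<Rightarrow> 'a set" where
  "lower_central br 0 = UNIV"
| "lower_central br (Suc k) = span {br x y | x y. y \<in> lower_central br k}"

definition nilpotent_bracket :: "('a::real_vector \<Rightarrow> 'a \<Rightarrow> 'a) \<Rightarrow> bool" where
  "nilpotent_bracket br \<longleftrightarrow> (\<exists>k. lower_central br k = {0})"

text \<open>
  The vector space \<open>\<gg> \<oplus> \<real> e\<^sub>0\<close> is modelled as \<open>\<gg> \<times> \<real>\<close> with \<open>e\<^sub>0 = (0, 1)\<close>, so that
  \<open>[v + s e\<^sub>0, w + t e\<^sub>0] = [v, w] + s D w - t D v\<close>.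
\<close>

definition semidirect ::
    "('a::real_vector \<Rightarrow> 'a \<Rightarrow> 'a) \<Rightarrow> ('a \<Rightarrow> 'a) \<Rightarrow> 'a \<times> real \<Rightarrow> 'a \<times> real \<Rightarrow> 'a \<times> real" where
  "semidirect br D = (\<lambda>(v, s) (w, t). (br v w + s *\<^sub>R D w - t *\<^sub>R D v, 0))"

definition e0 :: "'a::real_vector \<times> real" where
  "e0 = (0, 1)"

definition extend_metric ::
    "('a::real_vector \<Rightarrow> 'a \<Rightarrow> real) \<Rightarrow> real \<Rightarrow> 'a \<times> real \<Rightarrow> 'a \<times> real \<Rightarrow> real" where
  "extend_metric g \<tau> = (\<lambda>(v, s) (w, t). g v w + \<tau> * (s * t))"

definition z_standard_sasaki ::
    "('a::real_vector \<Rightarrow> 'a \<Rightarrow> 'a) \<Rightarrow> ('a \<Rightarrow> 'a \<Rightarrow> real) \<Rightarrow> ('a \<Rightarrow> 'a) \<Rightarrow> real \<Rightarrow>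
     ('a \<times> real \<Rightarrow> 'a \<times> real) \<Rightarrow> 'a \<times> real \<Rightarrow> ('a \<times> real \<Rightarrow> real) \<Rightarrow>
     ('a \<times> real \<Rightarrow> 'a \<times> real \<Rightarrow> real) \<Rightarrow> 'a \<Rightarrow> bool" where
  "z_standard_sasaki br g D \<tau> \<phi> \<xi> \<eta> gt b \<longleftrightarrow>
     sasaki (lie_of (semidirect br D)) \<phi> \<xi> \<eta> gt \<and>
     gt = extend_metric g \<tau> \<and>
     (b, 0) = - \<phi> e0 \<and>
     b \<in> center (lie_of br)"

text \<open>
  The quotient by an ideal \<open>I\<close>, on the set of cosets \<open>x + I\<close>. The summand \<open>I\<close> makes
  scaling correct for the scalar 0 and makes the set of brackets of representatives a full coset.
\<close>

definition quotient_lie :: "('a::real_vector \<Rightarrow> 'a \<Rightarrow> 'a) \<Rightarrow> 'a set \<Rightarrow> 'a set lie_struct" where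
  "quotient_lie br I =
     \<lparr>carrier = range (\<lambda>x. x +o I), vzero = I, vadd = (+),
      vscale = (\<lambda>c A. (\<lambda>a. c *\<^sub>R a) ` A + I),
      brac = (\<lambda>A B. {br a b | a b. a \<in> A \<and> b \<in> B} + I)\<rparr>"

end

theory Submission
  imports Defs
begin

text \<open>
  Everything follows from reading the two Sasaki conditions \<open>d\<eta> = 2\<Phi>\<close> and \<open>N\<^sub>\<phi> + d\<eta> \<otimes> \<xi> = 0\<close> on the
  decomposition \<open>\<gg> \<oplus> \<real>e\<^sub>0\<close>, in which \<open>b = - \<phi> e\<^sub>0\<close> is central in \<open>\<gg>\<close>.

  The position of \<open>\<xi>\<close>. Centrality of \<open>b\<close> gives \<open>\<Phi>(b, \<gg>) = 0\<close>, which forces \<open>\<eta>(e\<^sub>0) = 0\<close>: so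
  \<open>\<xi> \<in> \<gg>\<close>, \<open>\<phi> b = e\<^sub>0\<close> and the values of \<open>g\<close> on \<open>b\<close> and \<open>\<xi>\<close> follow (\<open>eta_e0\<close>). The radical of
  \<open>d\<eta>\<close> on \<open>\<gg>\<close> is the span of \<open>b\<close> and \<open>\<xi>\<close> (\<open>eta_br_radical\<close>). A nonzero skew endomorphism of a
  pseudo-Riemannian space can be nilpotent, so nilpotency of \<open>ad \<xi>\<close> alone does not make \<open>\<xi>\<close> central; instead
  the lower central series is used to find an element outside \<open>\<real>b\<close> whose brackets lie in \<open>\<real>b\<close>.
  It belongs to the radical, so \<open>ad \<xi>\<close> has image in \<open>\<real>b\<close>, and this image is zero because \<open>ad \<xi>\<close> is
  skew, \<open>ad \<xi> (b) = 0\<close> and \<open>g(b, b) \<noteq> 0\<close> (\<open>x_central\<close>).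

  The block form. \<open>D \<xi> = 0\<close> because \<open>ad \<xi>\<close> commutes with \<open>\<phi>\<close>; \<open>D b\<close> is central, hence in the radical;
  and normality on \<open>(e\<^sub>0, v)\<close> shows that \<open>D\<close> preserves \<open>V = {b, \<xi>}\<^sup>\<bottom>\<close> and commutes there with \<open>\<phi>\<close>
  (\<open>D_x\<close>, \<open>D_b\<close>, \<open>V_D\<close>, \<open>j_D\<close>). The quotient by the central plane spanned by \<open>b\<close> and \<open>\<xi>\<close> is
  therefore pseudo-Kaehler with \<open>\<omega> = d\<eta>/2\<close>, and \<open>D\<close> descends to a derivation commuting with \<open>J\<close>.

  The commutator. On the one hand \<open>\<eta>(D v) = - 2 \<Phi>(e\<^sub>0, v) = - 2 g(b, v)\<close> for all \<open>v \<in> \<gg>\<close>. For \<open>v = [u, w]\<close>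
  this expresses \<open>\<beta>(u, w) = g(b, [u, w])\<close> as \<open>2 g(S u, J w)\<close>, where \<open>S\<close> is the symmetric part of \<open>D\<close> on
  \<open>V\<close> (\<open>g_b_br\<close>). On the other hand the \<open>b\<close>-component of the derivation rule is
  \<open>h \<beta>(u, w) = \<beta>(D u, w) + \<beta>(u, D w)\<close>. Together they give \<open>h S = S D + D\<^sup>* S\<close> (\<open>D_second_order\<close>), which
  is the asserted identity.
\<close>

section \<open>Lie algebras, quotients and metrics on a type\<close>

lemma lie_of_simps [simp]:
  "carrier (lie_of br) = UNIV" "\<zero>\<^bsub>lie_of br\<^esub> = 0" "x \<oplus>\<^bsub>lie_of br\<^esub> y = x + y"
  "c \<odot>\<^bsub>lie_of br\<^esub> x = c *\<^sub>R x" "brac (lie_of br) = br" "x \<ominus>\<^bsub>lie_of br\<^esub> y = x - y"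
  by (simp_all add: lie_of_def vdiff_def)

lemma linear_map_lie_of [simp]: "linear_map (lie_of br) (lie_of br') f \<longleftrightarrow> linear f"
  by (auto simp: linear_map_def linear_iff)

lemma linear_form_lie_of [simp]: "linear_form (lie_of br) \<alpha> \<longleftrightarrow> linear \<alpha>"
  by (auto simp: linear_form_def linear_iff)

lemma pseudo_metric_lie_of:
  "pseudo_metric (lie_of br) g \<longleftrightarrow>
     bilinear g \<and> (\<forall>x y. g x y = g y x) \<and> (\<forall>x. (\<forall>y. g x y = 0) \<longrightarrow> x = 0)"
  by (auto simp: pseudo_metric_def bilinear_form_def bilinear_def)

lemma lie_algebra_lie_of:
  "lie_algebra (lie_of br) \<longleftrightarrow> bilinear br \<and> (\<forall>x. br x x = 0) \<and>
     (\<forall>x y z. br x (br y z) + br y (br z x) + br z (br x y) = 0)"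
  by (auto simp: lie_algebra_def real_vector_struct_def bilinear_def algebra_simps)

lemmas bilinear_simps = bilinear_ladd bilinear_radd bilinear_lmul bilinear_rmul bilinear_lneg
  bilinear_rneg bilinear_lsub bilinear_rsub bilinear_lzero bilinear_rzero

locale lie_bracket =
  fixes br :: "'v::real_vector \<Rightarrow> 'v \<Rightarrow> 'v"
  assumes lie: "lie_algebra (lie_of br)"
begin

lemma br_bilinear: "bilinear br"
  using lie by (simp add: lie_algebra_lie_of)

lemmas br_simps [simp] = bilinear_simps[OF br_bilinear]

lemma br_self [simp]: "br u u = 0"
  using lie by (simp add: lie_algebra_lie_of)

lemma br_skew: "br u w = - br w u"
proof -
  have "br (u + w) (u + w) = br u u + br u w + br w u + br w w" by (simp del: br_self)
  thus ?thesis by (simp add: eq_neg_iff_add_eq_0)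
qed

lemma jacobi: "br u (br v w) + br v (br w u) + br w (br u v) = 0"
  using lie by (simp add: lie_algebra_lie_of)

end

text \<open>A nondegenerate form identifies a space with its dual: in terms of a basis \<open>B\<close>, the map
  \<open>z \<mapsto> \<Sum>b\<in>B. g z b *\<^sub>R b\<close> is an injective endomorphism, hence surjective.\<close>

lemma nondegenerate_riesz:
  fixes g :: "'v::real_vector \<Rightarrow> 'v \<Rightarrow> real"
  assumes fin: "\<exists>B :: 'v set. finite B \<and> span B = UNIV"
    and g: "bilinear g" and nondeg: "\<And>z. (\<forall>y. g z y = 0) \<Longrightarrow> z = 0"
    and \<alpha>: "linear \<alpha>"
  obtains z where "\<And>y. g z y = \<alpha> y"
proof -
  obtain S :: "'v set" where S: "finite S" "span S = UNIV" using fin by blast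
  obtain B where B: "B \<subseteq> S" "independent B" "S \<subseteq> span B"
    using maximal_independent_subset[of S] by blast
  have finB: "finite B" using B S finite_subset by blast
  have spanB: "span B = UNIV" using B S span_mono[of S "span B"] by (simp add: span_span) blast
  interpret fd: finite_dimensional_vector_space "scaleR :: real \<Rightarrow> 'v \<Rightarrow> 'v" B
    by unfold_locales
      (use B finB spanB in \<open>simp_all add: dependent_raw_def span_raw_def\<close>)
  define F where "F z = (\<Sum>b\<in>B. g z b *\<^sub>R b)" for z
  have F_eq: "g z b = c b" if "F z = (\<Sum>b\<in>B. c b *\<^sub>R b)" "b \<in> B" for z b c
  proof -
    have "(\<Sum>b\<in>B. (g z b - c b) *\<^sub>R b) = 0"
      using that by (simp add: F_def scaleR_diff_left sum_subtractf)
    thus ?thesis using independentD[OF B(2) finB subset_refl, of "\<lambda>b. g z b - c b" b] that by simp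
  qed
  have lin2: "linear (g z)" for z using g by (simp add: bilinear_def)
  have eq_on_basis: "g z = \<beta>" if "\<And>b. b \<in> B \<Longrightarrow> g z b = \<beta> b" "linear \<beta>" for z \<beta>
    using linear_eq_on_span[OF lin2[of z] \<open>linear \<beta>\<close>, of B] that spanB by auto
  have linF: "linear F"
    by (rule linearI)
      (simp_all add: F_def bilinear_simps[OF g] scaleR_left_distrib sum.distrib scaleR_sum_right)
  have "inj F"
  proof (subst linear_injective_0[OF linF], intro allI impI)
    fix z assume "F z = 0"
    hence "g z = (\<lambda>_. 0)" by (intro eq_on_basis) (use F_eq[of z "\<lambda>_. 0"] in \<open>auto simp: linear_iff\<close>)
    thus "z = 0" using nondeg[of z] by (simp add: fun_eq_iff)
  qed
  hence "surj F" using fd.linear_inj_imp_surj linF by (simp add: linear_def)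
  then obtain z where "F z = (\<Sum>b\<in>B. \<alpha> b *\<^sub>R b)" by (metis surjD)
  hence "g z = \<alpha>" by (intro eq_on_basis F_eq \<alpha>)
  with that show thesis by metis
qed

locale lie_ideal = lie_bracket +
  fixes I :: "'v::real_vector set"
  assumes subspace: "subspace I"
    and ideal: "\<And>u z. z \<in> I \<Longrightarrow> br u z \<in> I"
begin

abbreviation coset ("\<pi>") where "\<pi> u \<equiv> u +o I"
abbreviation "Q \<equiv> quotient_lie br I"

lemma ideal_left: "z \<in> I \<Longrightarrow> br z u \<in> I"
  by (metis br_skew ideal subspace_neg[OF subspace])

lemma coset_eq_iff: "\<pi> u = \<pi> w \<longleftrightarrow> u - w \<in> I"
proof
  assume "\<pi> u = \<pi> w"
  moreover have "u \<in> \<pi> u" using subspace_0[OF subspace] set_plus_intro2[of 0 I u] by simp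
  ultimately show "u - w \<in> I" by (simp add: set_minus_plus)
next
  have *: "\<pi> u \<subseteq> \<pi> w" if "u - w \<in> I" for u w
  proof
    fix y assume "y \<in> \<pi> u"
    hence "(y - u) + (u - w) \<in> I"
      using that subspace_add[OF subspace] by (simp only: set_minus_plus[symmetric])
    thus "y \<in> \<pi> w" by (simp add: set_minus_plus[symmetric])
  qed
  assume "u - w \<in> I"
  moreover from this have "w - u \<in> I" using subspace_neg[OF subspace, of "u - w"] by simp
  ultimately show "\<pi> u = \<pi> w" using * by blast
qed

lemma ideal_plus_self: "I + I = I"
proof
  show "I + I \<subseteq> I" using subspace_add[OF subspace] by (auto simp: set_plus_def)
  show "I \<subseteq> I + I" by (rule set_zero_plus2[OF subspace_0[OF subspace]])
qed

lemma quotient_carrier [simp]: "carrier Q = range \<pi>"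
  by (simp add: quotient_lie_def)

lemma quotient_zero: "\<zero>\<^bsub>Q\<^esub> = \<pi> 0"
  by (simp add: quotient_lie_def)

lemma quotient_add [simp]: "\<pi> u \<oplus>\<^bsub>Q\<^esub> \<pi> w = \<pi> (u + w)"
  by (simp add: quotient_lie_def set_plus_rearrange ideal_plus_self)

lemma quotient_scale [simp]: "c \<odot>\<^bsub>Q\<^esub> \<pi> u = \<pi> (c *\<^sub>R u)"
proof -
  have "y \<in> (*\<^sub>R) c ` \<pi> u + I \<longleftrightarrow> y \<in> \<pi> (c *\<^sub>R u)" for y
  proof
    assume "y \<in> (*\<^sub>R) c ` \<pi> u + I"
    then obtain a z where "y = c *\<^sub>R (u + a) + z" "a \<in> I" "z \<in> I"
      by (auto simp: set_plus_def elt_set_plus_def)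
    thus "y \<in> \<pi> (c *\<^sub>R u)"
      using subspace_add[OF subspace subspace_scale[OF subspace]]
      by (simp add: set_minus_plus[symmetric] algebra_simps)
  next
    assume "y \<in> \<pi> (c *\<^sub>R u)"
    then obtain z where z: "z \<in> I" "y = c *\<^sub>R u + z" by (auto simp: elt_set_plus_def)
    moreover have "u \<in> \<pi> u" using subspace_0[OF subspace] set_plus_intro2[of 0 I u] by simp
    ultimately show "y \<in> (*\<^sub>R) c ` \<pi> u + I" by (auto intro!: set_plus_intro)
  qed
  thus ?thesis by (auto simp: quotient_lie_def)
qed

lemma quotient_brac [simp]: "brac Q (\<pi> u) (\<pi> w) = \<pi> (br u w)"
proof -
  have self: "v \<in> \<pi> v" for v using subspace_0[OF subspace] set_plus_intro2[of 0 I v] by simp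
  have "y \<in> {br a c | a c. a \<in> \<pi> u \<and> c \<in> \<pi> w} + I \<longleftrightarrow> y \<in> \<pi> (br u w)" for y
  proof
    assume "y \<in> {br a c | a c. a \<in> \<pi> u \<and> c \<in> \<pi> w} + I"
    then obtain a c z where y: "y = br (u + a) (w + c) + z" "a \<in> I" "c \<in> I" "z \<in> I"
      by (auto simp: set_plus_def elt_set_plus_def)
    have "y - br u w = br (u + a) c + br a w + z" using y by simp
    also have "\<dots> \<in> I"
      using y by (intro subspace_add[OF subspace] ideal ideal_left)
    finally show "y \<in> \<pi> (br u w)" by (simp only: set_minus_plus)
  next
    assume "y \<in> \<pi> (br u w)"
    then obtain z where "z \<in> I" "y = br u w + z" by (auto simp: elt_set_plus_def)
    thus "y \<in> {br a c | a c. a \<in> \<pi> u \<and> c \<in> \<pi> w} + I" using self by (auto intro!: set_plus_intro)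
  qed
  thus ?thesis by (auto simp: quotient_lie_def)
qed

lemma quotient_diff [simp]: "\<pi> u \<ominus>\<^bsub>Q\<^esub> \<pi> w = \<pi> (u - w)"
  by (simp add: vdiff_def)

lemma lie_algebra_quotient: "lie_algebra Q"
  unfolding lie_algebra_def real_vector_struct_def linear_map_def
  by (auto simp: quotient_zero jacobi[unfolded add.assoc] algebra_simps simp del: set_zero_plus)

lemma lie_hom_quotient: "lie_hom (lie_of br) Q \<pi>"
  by (simp add: lie_hom_def linear_map_def)

end

section \<open>Sasaki structures\<close>

locale sasaki_structure =
  fixes br :: "'v::real_vector \<Rightarrow> 'v \<Rightarrow> 'v" and \<phi> \<xi> \<eta> g
  assumes sasaki: "sasaki (lie_of br) \<phi> \<xi> \<eta> g"
begin

sublocale lie_bracket br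
  by unfold_locales (use sasaki in \<open>simp add: sasaki_def almost_contact_metric_def\<close>)

lemma g_bilinear: "bilinear g" and g_commute: "g u w = g w u"
  and nondegenerate: "(\<And>w. g u w = 0) \<Longrightarrow> u = 0"
  using sasaki by (auto simp: sasaki_def almost_contact_metric_def pseudo_metric_lie_of)

lemma phi_linear: "linear \<phi>" and eta_xi: "\<eta> \<xi> = 1" and eta_phi: "\<eta> (\<phi> u) = 0"
  and phi_phi: "\<phi> (\<phi> u) = \<eta> u *\<^sub>R \<xi> - u" and eta_flat: "\<eta> u = g \<xi> u"
  and g_phi_phi: "g (\<phi> u) (\<phi> w) = g u w - \<eta> u * \<eta> w"
  and d_eta: "- \<eta> (br u w) = 2 * g u (\<phi> w)"
  and normal: "\<phi> (\<phi> (br u w)) + br (\<phi> u) (\<phi> w) - \<phi> (br (\<phi> u) w) - \<phi> (br u (\<phi> w))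
    - \<eta> (br u w) *\<^sub>R \<xi> = 0"
  using sasaki
  by (auto simp: sasaki_def almost_contact_metric_def d1_def fundamental_form_def nijenhuis_def)

lemmas g_simps [simp] = bilinear_simps[OF g_bilinear]

lemma phi_xi: "\<phi> \<xi> = 0"
proof -
  have "\<phi> (\<phi> \<xi>) = 0" by (simp add: phi_phi eta_xi)
  hence "\<phi> (\<phi> (\<phi> \<xi>)) = 0" using phi_linear by (metis linear_0)
  thus ?thesis using phi_phi[of "\<phi> \<xi>"] by (simp only: eta_phi) simp
qed

lemma phi_skew: "g (\<phi> u) w = - g u (\<phi> w)"
proof -
  have "g (\<phi> u) (\<phi> (\<phi> w)) = g u (\<phi> w)" by (simp add: g_phi_phi eta_phi)
  moreover have "g (\<phi> u) \<xi> = 0" by (metis eta_flat eta_phi g_commute)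
  ultimately show ?thesis by (simp add: phi_phi)
qed

lemma eta_br_xi: "\<eta> (br \<xi> u) = 0"
  using d_eta[of \<xi> u] eta_phi[of u] by (simp add: eta_flat)

lemma ad_xi_commutes_phi: "\<phi> (br \<xi> u) = br \<xi> (\<phi> u)"
proof -
  have "- br \<xi> u - \<phi> (br \<xi> (\<phi> u)) = 0"
    using normal[of \<xi> u] phi_linear by (simp add: eta_br_xi phi_xi phi_phi linear_0)
  hence "\<phi> (br \<xi> u) = - \<phi> (\<phi> (br \<xi> (\<phi> u)))"
    using phi_linear by (metis add.inverse_inverse eq_iff_diff_eq_0 linear_neg)
  thus ?thesis by (simp add: phi_phi eta_br_xi)
qed

text \<open>The Reeb field is Killing: \<open>ad \<xi>\<close> preserves \<open>\<eta>\<close>, hence \<open>d\<eta> = 2\<Phi>\<close>, and it commutes with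
  \<open>\<phi>\<close>; on \<open>\<xi>\<close> itself skewness is \<open>\<eta> \<circ> ad \<xi> = 0\<close>.\<close>

lemma ad_xi_skew: "g (br \<xi> u) w = - g u (br \<xi> w)"
proof -
  have *: "g (br \<xi> u) (\<phi> v) = - g u (br \<xi> (\<phi> v))" for v
  proof -
    have "br \<xi> (br u v) = br (br \<xi> u) v + br u (br \<xi> v)"
      using jacobi[of \<xi> u v] br_skew[of v "br \<xi> u"] br_skew[of v \<xi>]
      by (simp add: algebra_simps add_eq_0_iff)
    hence "\<eta> (br (br \<xi> u) v) + \<eta> (br u (br \<xi> v)) = 0"
      using eta_br_xi[of "br u v"] by (simp add: eta_flat)
    thus ?thesis using d_eta[of "br \<xi> u" v] d_eta[of u "br \<xi> v"] by (simp add: ad_xi_commutes_phi)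
  qed
  have "g (br \<xi> u) \<xi> = 0" using eta_br_xi[of u] by (simp add: eta_flat g_commute)
  thus ?thesis using *[of "\<phi> w"] by (simp add: phi_phi)
qed

end

section \<open>The nilpotent ideal of a standard Sasaki algebra\<close>

locale z_standard_sasaki_algebra =
  fixes br :: "'g::real_vector \<Rightarrow> 'g \<Rightarrow> 'g" and g D \<tau> \<phi> \<xi> \<eta> gt b
  assumes fin_dim: "\<exists>B :: 'g set. finite B \<and> span B = UNIV"
    and nontrivial: "\<exists>v :: 'g. v \<noteq> 0"
    and lie_g: "lie_algebra (lie_of br)"
    and nilpotent: "nilpotent_bracket br"
    and metric_g: "pseudo_metric (lie_of br) g"
    and derivation: "derivation (lie_of br) D"
    and tau: "\<tau> = 1 \<or> \<tau> = -1"
    and z_standard: "z_standard_sasaki br g D \<tau> \<phi> \<xi> \<eta> gt b"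
begin

sublocale lie_bracket br
  by unfold_locales (rule lie_g)

sublocale S: sasaki_structure "semidirect br D" \<phi> \<xi> \<eta> gt
  by unfold_locales (use z_standard in \<open>unfold z_standard_sasaki_def, blast\<close>)

lemma tau_square [simp]: "\<tau> * \<tau> = 1" "\<tau> * (\<tau> * c) = c" "\<tau> \<noteq> 0"
  using tau by auto

lemma g_bilinear: "bilinear g" and g_commute: "g u w = g w u"
  and nondegenerate: "(\<And>w. g u w = 0) \<Longrightarrow> u = 0"
  using metric_g by (auto simp: pseudo_metric_lie_of)

lemmas g_simps [simp] = bilinear_simps[OF g_bilinear]

lemma D_linear: "linear D" and D_br: "D (br u w) = br (D u) w + br u (D w)"
  using derivation by (auto simp: derivation_def)

lemmas D_simps [simp] = linear_add[OF D_linear] linear_diff[OF D_linear] linear_neg[OF D_linear]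
  linear_scale[OF D_linear] linear_0[OF D_linear]

lemma b_central [simp]: "br b u = 0" "br u b = 0"
proof -
  show "br b u = 0" using z_standard by (simp add: z_standard_sasaki_def center_def)
  thus "br u b = 0" by (simp add: br_skew[of u])
qed

lemma semidirect_pair [simp]:
  "semidirect br D (v, s) (w, t) = (br v w + s *\<^sub>R D w - t *\<^sub>R D v, 0)"
  by (simp add: semidirect_def)

lemma gt_pair [simp]: "gt (v, s) (w, t) = g v w + \<tau> * (s * t)"
  using z_standard by (simp add: z_standard_sasaki_def extend_metric_def)

lemma phi_e0: "\<phi> (0, 1) = (- b, 0)"
proof -
  have "(b, 0) = - \<phi> (0, 1)" using z_standard by (simp add: z_standard_sasaki_def e0_def)
  hence "\<phi> (0, 1) = - (b, 0)" by simp
  thus ?thesis by simp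
qed

lemma eta_b: "\<eta> (b, 0) = 0"
  using S.eta_phi[of "(0, 1)"] S.g_simps(6)[of \<xi> "(b, 0)"] by (simp add: phi_e0 S.eta_flat)

lemma phi_b_aux: "\<phi> (b, 0) = (0, 1) - \<eta> (0, 1) *\<^sub>R \<xi>"
proof -
  have "\<phi> (\<phi> (0, 1)) = - \<phi> (b, 0)"
    using linear_neg[OF S.phi_linear, of "(b, 0)"] by (simp add: phi_e0)
  thus ?thesis using S.phi_phi[of "(0, 1)"] by (metis minus_diff_eq minus_minus)
qed

text \<open>Since \<open>b\<close> is central in \<open>\<gg>\<close>, \<open>d\<eta>\<close> vanishes on \<open>(b, v)\<close> for \<open>v \<in> \<gg>\<close>, so that
  \<open>\<eta>(e\<^sub>0) \<eta>(v) = \<Phi>(b, v) = 0\<close>. If \<open>\<eta>\<close> vanished on \<open>\<gg>\<close>, which contains all brackets, then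
  \<open>d\<eta> = 2\<Phi>\<close> would be zero, \<open>\<phi>\<close> too, and then
  \<open>v = \<eta>(v) \<xi> - \<phi>\<^sup>2 v = 0\<close> for all \<open>v \<in> \<gg>\<close>.\<close>

lemma eta_e0: "\<eta> (0, 1) = 0"
proof (rule ccontr)
  assume nz: "\<eta> (0, 1) \<noteq> 0"
  have eta_g: "\<eta> (v, 0) = 0" for v
  proof -
    have "gt (\<phi> (b, 0)) (v, 0) = 0"
      using S.d_eta[of "(b, 0)" "(v, 0)"] S.phi_skew[of "(b, 0)" "(v, 0)"]
      by (simp add: S.eta_flat zero_prod_def[symmetric])
    moreover have "gt (\<phi> (b, 0)) (v, 0) = - \<eta> (0, 1) * \<eta> (v, 0)"
      unfolding phi_b_aux by (simp add: S.eta_flat[of "(v, 0)"])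
    ultimately show ?thesis using nz by simp
  qed
  have phi_0: "\<phi> X = 0" for X
  proof (rule S.nondegenerate)
    fix Y
    have "\<eta> (semidirect br D X Y) = 0" by (cases X, cases Y) (simp add: eta_g)
    thus "gt (\<phi> X) Y = 0" using S.d_eta[of X Y] S.phi_skew[of X Y] by simp
  qed
  obtain v :: 'g where "v \<noteq> 0" using nontrivial by blast
  moreover have "(v, 0) = (0 :: 'g \<times> real)"
    using S.phi_phi[of "(v, 0)"] by (simp add: phi_0 eta_g zero_prod_def)
  ultimately show False by (simp add: zero_prod_def)
qed

abbreviation "x \<equiv> fst \<xi>"

lemma xi_eq: "\<xi> = (x, 0)"
proof -
  have "gt \<xi> (0, 1) = \<tau> * snd \<xi>" by (cases \<xi>) simp
  hence "snd \<xi> = 0" using eta_e0 tau by (auto simp: S.eta_flat)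
  thus ?thesis by (simp add: prod_eq_iff)
qed

lemma scale_xi: "c *\<^sub>R \<xi> = (c *\<^sub>R x, 0)"
  by (subst xi_eq) simp

lemma eta_pair [simp]: "\<eta> (v, s) = g x v"
  unfolding S.eta_flat by (subst xi_eq) simp

lemma phi_x: "\<phi> (x, 0) = (0, 0)"
  using S.phi_xi unfolding xi_eq[symmetric] by (simp add: zero_prod_def)

lemma phi_b: "\<phi> (b, 0) = (0, 1)"
  using phi_b_aux by (simp add: eta_e0 del: eta_pair)

lemma g_b_b [simp]: "g b b = \<tau>"
  using S.g_phi_phi[of "(0, 1)" "(0, 1)"] by (simp add: phi_e0)

lemma g_x_b [simp]: "g x b = 0" "g b x = 0"
  using eta_b by (simp_all add: g_commute[of b])

lemma g_x_x [simp]: "g x x = 1"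
  using S.eta_xi xi_eq eta_pair by metis

text \<open>\<open>\<phi>\<close> maps \<open>b\<close> to \<open>e\<^sub>0\<close>, so it does not preserve \<open>\<gg>\<close>. Its component in \<open>\<gg>\<close> kills \<open>b\<close> and \<open>\<xi>\<close> and is
  the complex structure on their orthogonal complement.\<close>

definition "j v = fst (\<phi> (v, 0))"

lemma phi_g: "\<phi> (v, 0) = (j v, \<tau> * g b v)"
proof -
  have "gt (\<phi> (v, 0)) (0, 1) = \<tau> * snd (\<phi> (v, 0))" by (cases "\<phi> (v, 0)") simp
  moreover have "gt (\<phi> (v, 0)) (0, 1) = g b v"
    by (simp add: S.phi_skew phi_e0 g_commute)
  ultimately have "\<tau> * (\<tau> * snd (\<phi> (v, 0))) = \<tau> * g b v" by simp
  thus ?thesis by (simp add: prod_eq_iff j_def)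
qed

lemma phi_pair: "\<phi> (v, s) = (j v - s *\<^sub>R b, \<tau> * g b v)"
proof -
  have "\<phi> (v, s) = \<phi> ((v, 0) + s *\<^sub>R (0, 1))" by simp
  also have "\<dots> = \<phi> (v, 0) + s *\<^sub>R \<phi> (0, 1)"
    by (simp only: linear_add[OF S.phi_linear] linear_scale[OF S.phi_linear])
  finally show ?thesis by (simp add: phi_g phi_e0)
qed

lemma j_linear: "linear j"
proof (rule linearI)
  fix u v and c :: real
  show "j (u + v) = j u + j v"
    using linear_add[OF S.phi_linear, of "(u, 0)" "(v, 0)"] by (simp add: j_def)
  show "j (c *\<^sub>R u) = c *\<^sub>R j u"
    using linear_scale[OF S.phi_linear, of c "(u, 0)"] by (simp add: j_def)
qed

lemmas j_simps [simp] = linear_add[OF j_linear] linear_diff[OF j_linear] linear_neg[OF j_linear]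
  linear_scale[OF j_linear] linear_0[OF j_linear]

lemma j_b [simp]: "j b = 0" and j_x [simp]: "j x = 0"
  using phi_b phi_g[of b] phi_x phi_g[of x] by simp_all

lemma j_orth [simp]: "g b (j v) = 0" "g x (j v) = 0"
proof -
  show "g x (j v) = 0" using S.eta_phi[of "(v, 0)"] by (simp add: phi_g)
  show "g b (j v) = 0" using S.phi_skew[of "(b, 0)" "(v, 0)"] by (simp add: phi_g)
qed

lemma j_skew: "g (j u) w = - g u (j w)"
  using S.phi_skew[of "(u, 0)" "(w, 0)"] by (simp add: phi_g)

lemma j_j: "j (j v) = g x v *\<^sub>R x + (\<tau> * g b v) *\<^sub>R b - v"
  using S.phi_phi[of "(v, 0)"] by (simp add: phi_pair scale_xi algebra_simps)

lemma eta_br: "- g x (br u w) = 2 * g u (j w)"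
  using S.d_eta[of "(u, 0)" "(w, 0)"] by (simp add: phi_g)

lemma eta_D: "g x (D v) = - 2 * g b v"
  using S.d_eta[of "(0, 1)" "(v, 0)"] by (simp add: phi_g)

text \<open>The radical of \<open>d\<eta>\<close> restricted to \<open>\<gg>\<close>: if \<open>\<Phi>(z, \<gg>) = 0\<close> then \<open>\<phi> z\<close> is orthogonal to \<open>\<gg>\<close>,
  hence a multiple of \<open>e\<^sub>0\<close>, and applying \<open>\<phi>\<close> again recovers \<open>z\<close>.\<close>

lemma eta_br_radical:
  assumes "\<And>v. g x (br z v) = 0"
  shows "z = g x z *\<^sub>R x + (\<tau> * g b z) *\<^sub>R b"
proof -
  have "j z = 0"
    by (rule nondegenerate) (use eta_br[of z] assms in \<open>simp add: j_skew\<close>)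
  thus ?thesis using j_j[of z] by simp
qed

text \<open>The lower central series of \<open>\<gg>\<close> starts outside \<open>\<real>b\<close> and ends inside it. The last term
  outside contains some \<open>z\<close> with \<open>[z, \<gg>] \<subseteq> \<real>b \<subseteq> ker \<eta>\<close>, so \<open>z = s b + t \<xi>\<close> with \<open>t \<noteq> 0\<close> and
  \<open>[\<xi>, \<gg>] \<subseteq> \<real>b\<close>. As \<open>ad \<xi>\<close> is skew and kills \<open>b\<close>, its image is also orthogonal to \<open>b\<close>.\<close>

lemma x_central [simp]: "br x u = 0" "br u x = 0"
proof -
  let ?L = "lower_central br"
  obtain k where "?L k = {0}" using nilpotent by (auto simp: nilpotent_bracket_def)
  hence "?L k \<subseteq> span {b}" by (simp add: span_zero)
  have "x \<notin> span {b}"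
  proof
    assume "x \<in> span {b}"
    then obtain c where "x = c *\<^sub>R b" by (auto simp: span_singleton)
    hence "g x x = c * g x b" by (metis g_simps(4) real_scaleR_def)
    thus False by simp
  qed
  hence "\<not> ?L 0 \<subseteq> span {b}" by auto
  with \<open>?L k \<subseteq> span {b}\<close> obtain i
    where i: "\<not> ?L i \<subseteq> span {b}" "?L (Suc i) \<subseteq> span {b}"
    using ex_least_nat_less[of "\<lambda>i. ?L i \<subseteq> span {b}" k] by blast
  then obtain z where z: "z \<in> ?L i" "z \<notin> span {b}" by blast
  have z_br: "br z v \<in> span {b}" for v
  proof -
    have "br v z \<in> span {b}" using i(2) z(1) by (force intro: span_base)
    thus ?thesis by (metis br_skew span_neg)
  qed
  have "g x (br z v) = 0" for v using z_br[of v] by (auto simp: span_singleton)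
  hence z_eq: "z = g x z *\<^sub>R x + (\<tau> * g b z) *\<^sub>R b" by (rule eta_br_radical)
  hence nz: "g x z \<noteq> 0"
    using z(2) by (metis add_0 rangeI scaleR_zero_left span_singleton)
  have "br x v \<in> span {b}" for v
  proof -
    have "br z v = g x z *\<^sub>R br x v" by (subst z_eq) simp
    hence "br x v = inverse (g x z) *\<^sub>R br z v" using nz by simp
    thus ?thesis using z_br span_scale by metis
  qed
  then obtain c where c: "br x u = c *\<^sub>R b" by (auto simp: span_singleton)
  have "g (br x u) b = 0"
    using S.ad_xi_skew[of "(u, 0)" "(b, 0)"] by (subst (asm) (1 2) xi_eq) simp
  thus "br x u = 0" using c tau by auto
  thus "br u x = 0" by (simp add: br_skew[of u])
qed

text \<open>As \<open>ad \<xi>\<close> commutes with \<open>\<phi>\<close> and \<open>\<phi> b = e\<^sub>0\<close>, the relation \<open>[\<xi>, b] = 0\<close> is carried to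
  \<open>[\<xi>, e\<^sub>0] = 0\<close>.\<close>

lemma D_x [simp]: "D x = 0"
proof -
  have "\<phi> (semidirect br D \<xi> (b, 0)) = semidirect br D \<xi> (0, 1)"
    by (simp only: S.ad_xi_commutes_phi phi_b)
  thus ?thesis by (subst (asm) (1 2) xi_eq) (simp add: phi_pair)
qed

definition "h = \<tau> * g b (D b)"

text \<open>A derivation preserves the center of \<open>\<gg>\<close>, and the center lies in the radical of \<open>d\<eta>\<close>, that is, in the
  span of \<open>b\<close> and \<open>\<xi>\<close>. The coefficient of \<open>\<xi>\<close> is \<open>\<eta>(D b) = - 2 \<Phi>(e\<^sub>0, b)\<close>.\<close>

lemma D_b: "D b = h *\<^sub>R b - (2 * \<tau>) *\<^sub>R x"
proof -
  have "br (D b) v = 0" for v using D_br[of b v] by simp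
  hence "D b = g x (D b) *\<^sub>R x + (\<tau> * g b (D b)) *\<^sub>R b" by (intro eta_br_radical) simp
  thus ?thesis by (simp add: eta_D h_def)
qed

definition "V = {v. g b v = 0 \<and> g x v = 0}"

lemma j_V: "j v \<in> V"
  by (simp add: V_def)

lemma j_j_V: "v \<in> V \<Longrightarrow> j (j v) = - v"
  by (simp add: j_j V_def)

text \<open>Normality on \<open>(e\<^sub>0, v)\<close> reads \<open>\<phi>\<^sup>2 D v = \<phi> D \<phi> v\<close>. Its \<open>e\<^sub>0\<close>-component says that \<open>D (\<phi> v)\<close> is
  orthogonal to \<open>b\<close>, and every element of \<open>V\<close> has the form \<open>\<phi> v\<close>.\<close>

lemma V_D: "v \<in> V \<Longrightarrow> D v \<in> V" and j_D: "v \<in> V \<Longrightarrow> j (D v) = D (j v)"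
proof -
  have *: "g b (D (j v)) = 0 \<and> - D v = j (D (j v))" if "v \<in> V" for v
    using S.normal[of "(0, 1)" "(v, 0)"] that
    by (auto simp: phi_pair V_def eta_D j_j scale_xi zero_prod_def add_eq_0_iff)
  assume v: "v \<in> V"
  (* v = j (j (- v)) *)
  have "g b (D v) = 0" using *[OF j_V[of "- v"]] by (simp add: j_j_V[OF v])
  thus "D v \<in> V" using v by (simp add: V_def eta_D)
  show "j (D v) = D (j v)" using *[OF j_V[of v]] by (simp add: j_j_V[OF v])
qed

text \<open>The component in \<open>\<gg>\<close> of the normality condition; modulo \<open>b\<close> and \<open>\<xi>\<close> it is the vanishing of
  the Nijenhuis tensor of the complex structure.\<close>

lemma integrable:
  assumes "u \<in> V" "w \<in> V"
  shows "br (j u) (j w) - br u w - j (br (j u) w) - j (br u (j w)) = 0"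
  using S.normal[of "(u, 0)" "(w, 0)"] assms
  by (simp add: phi_pair V_def j_j scale_xi zero_prod_def algebra_simps)

section \<open>The quotient by the span of \<open>b\<close> and \<open>\<xi>\<close>\<close>

lemma span_b_x: "z \<in> span {b, x} \<longleftrightarrow> (\<exists>s t. z = s *\<^sub>R b + t *\<^sub>R x)"
  by (auto simp: span_insert diff_eq_eq add.commute)

sublocale lie_ideal br "span {b, x}"
  by unfold_locales (auto simp: span_b_x intro!: exI[of _ 0])

abbreviation coset_b_x ("\<pi>") where "\<pi> u \<equiv> u +o span {b, x}"

definition "orth_proj y = y - (\<tau> * g b y) *\<^sub>R b - g x y *\<^sub>R x"

lemma orth_proj_V: "orth_proj y \<in> V"
  by (simp add: orth_proj_def V_def mult.commute)

lemma orth_proj_eq: "v \<in> V \<Longrightarrow> orth_proj v = v"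
  by (simp add: orth_proj_def V_def)

lemma orth_proj_b [simp]: "orth_proj b = 0" and orth_proj_x [simp]: "orth_proj x = 0"
  by (simp_all add: orth_proj_def)

lemma orth_proj_linear: "linear orth_proj"
  by (rule linearI) (simp_all add: orth_proj_def algebra_simps)

lemma coset_orth_proj: "\<pi> (orth_proj y) = \<pi> y"
  unfolding coset_eq_iff span_b_x
  by (intro exI[of _ "- (\<tau> * g b y)"] exI[of _ "- g x y"]) (simp add: orth_proj_def)

text \<open>The metric is nondegenerate on \<open>V\<close>, because \<open>\<gg>\<close> is the orthogonal sum of \<open>V\<close> and the span of \<open>b\<close> and
  \<open>\<xi>\<close>.\<close>

lemma V_eqI:
  assumes "u \<in> V" "w \<in> V" "\<And>v. v \<in> V \<Longrightarrow> g v u = g v w"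
  shows "u = w"
proof -
  have "g (u - w) y = 0" for y
  proof -
    have "g (u - w) y = g (orth_proj y) (u - w)"
      using assms(1,2) g_commute[of "u - w" y]
      by (simp add: orth_proj_def V_def)
    thus ?thesis using assms(3)[OF orth_proj_V[of y]] by simp
  qed
  hence "u - w = 0" by (rule nondegenerate)
  thus ?thesis by simp
qed

lemma inj_on_coset: "inj_on \<pi> V"
proof (rule inj_onI)
  fix u w assume "u \<in> V" "w \<in> V" "\<pi> u = \<pi> w"
  hence "orth_proj (u - w) = 0" "u - w \<in> V"
    by (auto simp: coset_eq_iff span_b_x V_def linear_add[OF orth_proj_linear]
        linear_scale[OF orth_proj_linear])
  thus "u = w" by (simp add: orth_proj_eq)
qed

lemma quotient_carrier_V: "carrier Q = \<pi> ` V"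
  using coset_orth_proj orth_proj_V by (auto simp: image_iff)

definition "horizontal_lift = the_inv_into V \<pi>"

lemma horizontal_lift_coset [simp]: "horizontal_lift (\<pi> y) = orth_proj y"
  unfolding horizontal_lift_def by (intro the_inv_into_f_eq inj_on_coset coset_orth_proj orth_proj_V)

text \<open>All structures on the quotient are transported from \<open>V\<close>. On \<open>\<omega>\<close>, \<open>J\<close> and \<open>D\<close> the choice of
  representative is immaterial: \<open>b\<close> and \<open>\<xi>\<close> are central, \<open>j\<close> kills their span and \<open>D\<close> preserves it.
  The metric has to be evaluated on horizontal representatives.\<close>

definition "gq A B = g (horizontal_lift A) (horizontal_lift B)"
definition "J A = \<pi> (j (horizontal_lift A))"
definition "\<omega> A B = - (1/2) * g x (br (horizontal_lift A) (horizontal_lift B))"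
definition "Dq A = \<pi> (D (horizontal_lift A))"

lemma gq_coset: "u \<in> V \<Longrightarrow> w \<in> V \<Longrightarrow> gq (\<pi> u) (\<pi> w) = g u w"
  by (simp add: gq_def orth_proj_eq)

lemma J_coset [simp]: "J (\<pi> y) = \<pi> (j y)"
  by (simp add: J_def orth_proj_def)

lemma omega_coset [simp]: "\<omega> (\<pi> u) (\<pi> w) = - (1/2) * g x (br u w)"
  by (simp add: \<omega>_def orth_proj_def)

lemma Dq_coset [simp]: "Dq (\<pi> y) = \<pi> (D y)"
proof -
  have "D (orth_proj y) - D y = (- (\<tau> * g b y)) *\<^sub>R D b" by (simp add: orth_proj_def)
  also have "\<dots> \<in> span {b, x}"
    unfolding D_b by (intro span_scale span_diff) (auto intro: span_base)
  finally show ?thesis by (simp add: Dq_def coset_eq_iff)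
qed

lemma pseudo_metric_gq: "pseudo_metric Q gq"
proof -
  have "bilinear_form Q gq"
    by (auto simp: bilinear_form_def linear_form_def gq_def linear_add[OF orth_proj_linear]
        linear_scale[OF orth_proj_linear])
  moreover have "A = \<zero>\<^bsub>Q\<^esub>" if A: "A \<in> carrier Q" "\<forall>B\<in>carrier Q. gq A B = 0" for A
  proof -
    obtain u where u: "u \<in> V" "A = \<pi> u" using A(1) unfolding quotient_carrier_V by blast
    have "g v u = g v 0" if v: "v \<in> V" for v
    proof -
      have "gq A (\<pi> v) = 0" using A(2) by simp
      thus ?thesis using u v by (simp add: gq_coset g_commute)
    qed
    hence "u = 0" using u by (intro V_eqI) (auto simp: V_def)
    thus ?thesis by (simp add: u quotient_zero)
  qed
  ultimately show ?thesis by (auto simp: pseudo_metric_def gq_def g_commute)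
qed

text \<open>\<open>\<omega>\<close> pulls back to \<open>d\<eta>/2\<close>, so it is closed by the Jacobi identity and agrees with
  \<open>g(\<cdot>, J \<cdot>)\<close> by the Sasaki condition; integrability of \<open>J\<close> is normality.\<close>

lemma pseudo_kaehler_quotient: "pseudo_kaehler Q gq J \<omega>"
  unfolding pseudo_kaehler_def
proof (intro conjI ballI lie_algebra_quotient pseudo_metric_gq)
  show "endomorphism Q J" by (auto simp: linear_map_def)
  show "two_form Q \<omega>"
    by (auto simp: two_form_def bilinear_form_def linear_form_def algebra_simps)
      (subst br_skew, simp)
next
  fix A assume "A \<in> carrier Q"
  then obtain u where u: "u \<in> V" "A = \<pi> u" unfolding quotient_carrier_V by blast
  thus "J (J A) = (-1) \<odot>\<^bsub>Q\<^esub> A" by (simp add: j_j_V)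
  fix B assume "B \<in> carrier Q"
  then obtain w where w: "w \<in> V" "B = \<pi> w" unfolding quotient_carrier_V by blast
  show "gq (J A) (J B) = gq A B" using u w by (simp add: gq_coset j_V j_skew j_j_V)
  show "\<omega> A B = gq A (J B)" using u w eta_br[of u w] by (simp add: gq_coset j_V)
  have "\<pi> (j (j (br u w))) = \<pi> (- br u w)"
    unfolding coset_eq_iff span_b_x j_j
    by (intro exI[of _ "\<tau> * g b (br u w)"] exI[of _ "g x (br u w)"]) simp
  hence "nijenhuis Q J A B =
      \<pi> (- br u w) \<oplus>\<^bsub>Q\<^esub> \<pi> (br (j u) (j w) - j (br (j u) w) - j (br u (j w)))"
    using u w by (simp add: nijenhuis_def add_diff_eq)
  also have "\<dots> = \<pi> 0" using integrable[OF u(1) w(1)] by (simp add: algebra_simps)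
  finally show "nijenhuis Q J A B = \<zero>\<^bsub>Q\<^esub>" by (simp only: quotient_zero)
next
  fix A B C assume "A \<in> carrier Q" "B \<in> carrier Q" "C \<in> carrier Q"
  then obtain u v w where *: "A = \<pi> u" "B = \<pi> v" "C = \<pi> w" by auto
  have "g x (br u (br v w) + br v (br w u) + br w (br u v)) = 0" by (simp only: jacobi g_simps)
  thus "d2 Q \<omega> A B C = 0"
    using br_skew[of "br u v" w] br_skew[of "br v w" u] br_skew[of "br u w" v] br_skew[of u w]
    by (simp add: * d2_def)
qed

lemma orth_compl_span: "orth_compl (lie_of br) g (span {b, x}) = V"
proof -
  have "g v s = 0" if "v \<in> V" "s \<in> span {b, x}" for v s
    using that by (auto simp: V_def span_b_x g_commute[of v])
  moreover have "v \<in> V" if v: "\<forall>s\<in>span {b, x}. g v s = 0" for v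
    using v[rule_format, of b] v[rule_format, of x]
    by (simp add: V_def g_commute[of _ v] span_base)
  ultimately show ?thesis by (auto simp: orth_compl_def)
qed

lemma riemannian_submersion_quotient: "riemannian_submersion (lie_of br) g \<pi> Q gq"
proof -
  have "{y \<in> carrier (lie_of br). \<pi> y = \<zero>\<^bsub>Q\<^esub>} = span {b, x}"
    by (simp add: quotient_zero coset_eq_iff del: set_zero_plus)
  thus ?thesis
    using inj_on_coset quotient_carrier_V lie_hom_quotient
    by (simp add: riemannian_submersion_def orth_compl_span bij_betw_def gq_coset)
qed

lemma orthogonal_splitting: "\<exists>!(v, s, t). v \<in> V \<and> y = v + s *\<^sub>R b + t *\<^sub>R x"
proof (rule ex1I[of _ "(orth_proj y, \<tau> * g b y, g x y)"])
  show "case (orth_proj y, \<tau> * g b y, g x y) of (v, s, t) \<Rightarrow> v \<in> V \<and> y = v + s *\<^sub>R b + t *\<^sub>R x"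
    by (simp add: orth_proj_V) (simp add: orth_proj_def)
next
  fix q assume "case q of (v, s, t) \<Rightarrow> v \<in> V \<and> y = v + s *\<^sub>R b + t *\<^sub>R x"
  thus "q = (orth_proj y, \<tau> * g b y, g x y)"
    by (auto simp: V_def orth_proj_def mult.commute)
qed

lemma Dq_transport: "Dq = (\<lambda>A. \<pi> (D (the_inv_into V \<pi> A)))"
  by (rule ext) (simp only: Dq_def horizontal_lift_def)

lemma D_block: "D (v + s *\<^sub>R b + t *\<^sub>R x) = D v + (h * s) *\<^sub>R b + (-2 * \<tau> * s) *\<^sub>R x"
  by (simp add: D_b algebra_simps)

lemma omega_d_eta: "\<omega> (\<pi> u) (\<pi> w) = (1/2) * d1 (lie_of br) (\<lambda>v. \<eta> (v, 0)) u w"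
  by (simp add: d1_def)

lemma x_center: "x \<in> center (lie_of br)"
  by (simp add: center_def)

lemma derivation_Dq: "derivation Q Dq"
  by (auto simp: derivation_def linear_map_def D_br)

lemma commutator_J_Dq: "A \<in> carrier Q \<Longrightarrow> commutator Q J Dq A = \<zero>\<^bsub>Q\<^esub>"
  unfolding quotient_carrier_V
  by (auto simp: commutator_def quotient_zero j_D simp del: set_zero_plus)

text \<open>Both sides are half of \<open>\<eta>(D [u, w])\<close>, which only sees the \<open>b\<close>-component of
  \<open>[u, w]\<close> because \<open>\<eta> \<circ> D = - 2 b\<^sup>\<flat>\<close>.\<close>

lemma act2_Dq_omega: "act2 Dq \<omega> (\<pi> u) (\<pi> w) = d1 (lie_of br) (g b) u w"
  using eta_D[of "br u w"] by (simp add: act2_def d1_def D_br)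

section \<open>The identity for the symmetric and skew parts of the derivation\<close>

lemma g_b_D: "g b (D y) = h * g b y"
proof -
  have "D y = D (orth_proj y) + (\<tau> * g b y) *\<^sub>R D b" by (simp add: orth_proj_def)
  moreover have "g b (D (orth_proj y)) = 0" using V_D[OF orth_proj_V[of y]] by (simp add: V_def)
  ultimately show ?thesis by (simp add: D_b)
qed

text \<open>The relation \<open>\<eta> \<circ> D = - 2 b\<^sup>\<flat>\<close>, evaluated on a bracket, turns the \<open>b\<close>-component of \<open>[u, w]\<close> into
  \<open>d\<eta>\<close>, hence into the metric.\<close>

lemma g_b_br:
  assumes "u \<in> V" "w \<in> V"
  shows "g b (br u w) = g (D u) (j w) + g u (D (j w))"
proof -
  have "- 2 * g b (br u w) = g x (br (D u) w) + g x (br u (D w))"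
    using eta_D[of "br u w"] by (simp add: D_br)
  thus ?thesis
    using eta_br[of "D u" w] eta_br[of u "D w"] j_D[OF assms(2)] by simp
qed

text \<open>\<open>D\<close> is a derivation and multiplies the \<open>b\<close>-component by \<open>h\<close>. In the formula above this
  is a statement about the form \<open>g(D u, w) + g(u, D w)\<close>, because \<open>j\<close> commutes with \<open>D\<close> and is
  invertible on \<open>V\<close>.\<close>

lemma D_second_order:
  assumes "u \<in> V" "w \<in> V"
  shows "h * (g (D u) w + g u (D w)) = g (D (D u)) w + 2 * g (D u) (D w) + g u (D (D w))"
proof -
  define w' where "w' = - j w"
  have w': "w' \<in> V" "j w' = w" using j_V[of "- w"] assms(2) by (simp_all add: w'_def j_j_V)
  have "h * g b (br u w') = g b (br (D u) w') + g b (br u (D w'))"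
    using g_b_D[of "br u w'"] by (simp add: D_br)
  thus ?thesis
    using assms w' V_D j_D[OF w'(1)] by (simp add: g_b_br)
qed

text \<open>The functional \<open>u \<mapsto> g(D u, y)\<close> on \<open>V\<close> is extended by zero on \<open>b\<close> and \<open>\<xi>\<close>, so that the vector
  representing it in \<open>\<gg>\<close> lies in \<open>V\<close>.\<close>

lemma V_adjoint_exists:
  assumes "y \<in> V"
  shows "\<exists>z. z \<in> V \<and> (\<forall>u\<in>V. g (D u) y = g u z)"
proof -
  have "linear (\<lambda>u. g (D (orth_proj u)) y)"
    by (rule linearI) (simp_all add: linear_add[OF orth_proj_linear] linear_scale[OF orth_proj_linear])
  then obtain z where z: "\<And>u. g z u = g (D (orth_proj u)) y"
    using nondegenerate_riesz[OF fin_dim g_bilinear nondegenerate] by metis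
  hence "z \<in> V" using z[of b] z[of x] by (simp add: V_def g_commute)
  moreover have "g (D u) y = g u z" if "u \<in> V" for u
    using z[of u] that by (simp add: orth_proj_eq g_commute)
  ultimately show ?thesis by blast
qed

definition "D_adj y = (SOME z. z \<in> V \<and> (\<forall>u\<in>V. g (D u) y = g u z))"

lemma D_adj_V: "y \<in> V \<Longrightarrow> D_adj y \<in> V"
  and g_D_adj: "y \<in> V \<Longrightarrow> u \<in> V \<Longrightarrow> g u (D_adj y) = g (D u) y"
  using someI_ex[OF V_adjoint_exists, of y] by (auto simp: D_adj_def)

lemma adj_Dq:
  assumes "y \<in> V"
  shows "adj Q gq Dq (\<pi> y) = \<pi> (D_adj y)"
  unfolding adj_def quotient_carrier_V
proof (rule the_equality)
  show "\<pi> (D_adj y) \<in> \<pi> ` V \<and> (\<forall>A\<in>\<pi> ` V. gq (Dq A) (\<pi> y) = gq A (\<pi> (D_adj y)))"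
    using assms D_adj_V V_D by (auto simp: gq_coset g_D_adj)
next
  fix Z assume Z: "Z \<in> \<pi> ` V \<and> (\<forall>A\<in>\<pi> ` V. gq (Dq A) (\<pi> y) = gq A Z)"
  then obtain z where z: "z \<in> V" "Z = \<pi> z" by blast
  have "z = D_adj y"
    using assms Z z by (intro V_eqI D_adj_V) (auto simp: gq_coset g_D_adj V_D)
  thus "Z = \<pi> (D_adj y)" by (simp add: z)
qed

definition "D_sym u = (1/2) *\<^sub>R (D u + D_adj u)"
definition "D_skew u = (1/2) *\<^sub>R (D u - D_adj u)"

lemma V_closed: "u \<in> V \<Longrightarrow> w \<in> V \<Longrightarrow> u + w \<in> V" "u \<in> V \<Longrightarrow> w \<in> V \<Longrightarrow> u - w \<in> V"
  "u \<in> V \<Longrightarrow> c *\<^sub>R u \<in> V"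
  by (simp_all add: V_def)

lemma D_sym_V: "u \<in> V \<Longrightarrow> D_sym u \<in> V" and D_skew_V: "u \<in> V \<Longrightarrow> D_skew u \<in> V"
  by (auto simp: D_sym_def D_skew_def intro!: V_closed V_D D_adj_V)

lemma sym_part_Dq: "u \<in> V \<Longrightarrow> sym_part Q gq Dq (\<pi> u) = \<pi> (D_sym u)"
  and skew_part_Dq: "u \<in> V \<Longrightarrow> skew_part Q gq Dq (\<pi> u) = \<pi> (D_skew u)"
  by (simp_all add: sym_part_def skew_part_def adj_Dq D_sym_def D_skew_def)

lemma g_D_sym: "u \<in> V \<Longrightarrow> w \<in> V \<Longrightarrow> g w (D_sym u) = (g w (D u) + g (D w) u) / 2"
  and g_D_skew: "u \<in> V \<Longrightarrow> w \<in> V \<Longrightarrow> g w (D_skew u) = (g w (D u) - g (D w) u) / 2"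
  by (simp_all add: D_sym_def D_skew_def g_D_adj)

text \<open>Write \<open>D = S + A\<close>, so that \<open>D\<^sup>* = S - A\<close>. Then \<open>D_second_order\<close> says
  \<open>h S = S D + D\<^sup>* S = 2 S\<^sup>2 + [S, A]\<close>. Both sides are compared after pairing with \<open>w \<in> V\<close>, which expresses
  everything by \<open>g\<close>, \<open>D\<close> and \<open>D\<^sup>*\<close>.\<close>

lemma D_sym_D_skew_commutator:
  assumes u: "u \<in> V"
  shows "D_sym (D_skew u) - D_skew (D_sym u) = h *\<^sub>R D_sym u - 2 *\<^sub>R D_sym (D_sym u)"
proof (rule V_eqI)
  fix w assume w: "w \<in> V"
  have "D (D_skew u) = (1/2) *\<^sub>R (D (D u) - D (D_adj u))" "D (D_sym u) = (1/2) *\<^sub>R (D (D u) + D (D_adj u))"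
    by (simp_all add: D_sym_def D_skew_def)
  thus "g w (D_sym (D_skew u) - D_skew (D_sym u)) = g w (h *\<^sub>R D_sym u - 2 *\<^sub>R D_sym (D_sym u))"
    using D_second_order[OF w u] u w
    by (simp add: g_D_sym g_D_skew D_sym_V D_skew_V V_D) (simp add: field_simps)
qed (use u in \<open>auto intro!: V_closed D_sym_V D_skew_V\<close>)

lemma sym_skew_commutator:
  assumes "A \<in> carrier Q"
  shows "commutator Q (sym_part Q gq Dq) (skew_part Q gq Dq) A =
    h \<odot>\<^bsub>Q\<^esub> sym_part Q gq Dq A \<ominus>\<^bsub>Q\<^esub> 2 \<odot>\<^bsub>Q\<^esub> sym_part Q gq Dq (sym_part Q gq Dq A)"
proof -
  obtain u where "u \<in> V" "A = \<pi> u" using assms unfolding quotient_carrier_V by blast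
  thus ?thesis
    by (simp add: commutator_def sym_part_Dq skew_part_Dq D_sym_V D_skew_V D_sym_D_skew_commutator)
qed

end

theorem corollary4p4:
  fixes br :: "'g::real_vector \<Rightarrow> 'g \<Rightarrow> 'g"
    and g :: "'g \<Rightarrow> 'g \<Rightarrow> real"
    and D :: "'g \<Rightarrow> 'g"
    and \<tau> :: real
    and n :: nat
    and \<phi> :: "'g \<times> real \<Rightarrow> 'g \<times> real"
    and \<xi> :: "'g \<times> real"
    and \<eta> :: "'g \<times> real \<Rightarrow> real"
    and gt :: "'g \<times> real \<Rightarrow> 'g \<times> real \<Rightarrow> real"
    and b :: 'g
  assumes fin_dim: "\<exists>B :: 'g set. finite B \<and> span B = UNIV"
    and dim: "dim (UNIV :: ('g \<times> real) set) = 2 * n + 1" "n \<ge> 1"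
    and lie: "lie_algebra (lie_of br)"
    and nilpotent: "nilpotent_bracket br"
    and metric: "pseudo_metric (lie_of br) g"
    and derivation: "derivation (lie_of br) D"
    and tau: "\<tau> = 1 \<or> \<tau> = -1"
    and sasaki: "z_standard_sasaki br g D \<tau> \<phi> \<xi> \<eta> gt b"
  shows "\<exists>x h. \<xi> = (x, 0) \<and> x \<in> center (lie_of br) \<and>
    g x x = 1 \<and> g b b = \<tau> \<and> g b x = 0 \<and>
    (let I = span {b, x};
         V = orth_compl (lie_of br) g I;
         Q = quotient_lie br I;
         p = (\<lambda>v. v +o I)
     in \<exists>gq J \<omega> Dv Dq.
          \<comment> \<open>\<open>Dv\<close> is the endomorphism of \<open>V\<close> in the block form of \<open>D\<close>,
             \<open>Dq\<close> is its transport along the identification \<open>p\<close> of \<open>V\<close> with the quotient\<close>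
          Dq = (\<lambda>A. p (Dv (the_inv_into V p A))) \<and>
          pseudo_kaehler Q gq J \<omega> \<and>
          riemannian_submersion (lie_of br) g p Q gq \<and>
          (\<forall>u w. \<omega> (p u) (p w) = (1/2) * d1 (lie_of br) (\<lambda>v. \<eta> (v, 0)) u w) \<and>
          (\<forall>u w. act2 Dq \<omega> (p u) (p w) = d1 (lie_of br) (g b) u w) \<and>
          (\<forall>y. \<exists>!(v, s, t). v \<in> V \<and> y = v + s *\<^sub>R b + t *\<^sub>R x) \<and>
          (\<forall>v\<in>V. Dv v \<in> V) \<and>
          (\<forall>v\<in>V. \<forall>s t. D (v + s *\<^sub>R b + t *\<^sub>R x) = Dv v + (h * s) *\<^sub>R b + (-2 * \<tau> * s) *\<^sub>R x) \<and>
          (\<forall>A\<in>carrier Q. commutator Q J Dq A = \<zero>\<^bsub>Q\<^esub>) \<and>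
          derivation Q Dq \<and>
          (\<forall>A\<in>carrier Q. commutator Q (sym_part Q gq Dq) (skew_part Q gq Dq) A =
             h \<odot>\<^bsub>Q\<^esub> sym_part Q gq Dq A \<ominus>\<^bsub>Q\<^esub> 2 \<odot>\<^bsub>Q\<^esub> sym_part Q gq Dq (sym_part Q gq Dq A)))"
proof -
  have nontrivial: "\<exists>v :: 'g. v \<noteq> 0"
  proof (rule ccontr)
    assume "\<not> (\<exists>v :: 'g. v \<noteq> 0)"
    hence "y = snd y *\<^sub>R (0, 1)" for y :: "'g \<times> real"
      by (metis prod.collapse scaleR_Pair real_scaleR_def mult.right_neutral)
    hence "(UNIV :: ('g \<times> real) set) \<subseteq> span {(0, 1)}" unfolding span_singleton by blast
    hence "dim (UNIV :: ('g \<times> real) set) \<le> card {(0 :: 'g, 1 :: real)}"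
      by (intro dim_le_card) auto
    thus False using dim by simp
  qed
  interpret Z: z_standard_sasaki_algebra br g D \<tau> \<phi> \<xi> \<eta> gt b
    by (rule z_standard_sasaki_algebra.intro
        [OF fin_dim nontrivial lie nilpotent metric derivation tau sasaki])
  show ?thesis
    unfolding Let_def
    by (intro exI[of _ "fst \<xi>"] exI[of _ Z.h] conjI Z.xi_eq Z.x_center Z.g_x_x Z.g_b_b Z.g_x_b,
        rule exI[of _ Z.gq], rule exI[of _ Z.J], rule exI[of _ Z.\<omega>], rule exI[of _ D],
        rule exI[of _ Z.Dq], unfold Z.orth_compl_span, intro conjI allI ballI)
      (rule Z.Dq_transport Z.pseudo_kaehler_quotient Z.riemannian_submersion_quotient
        Z.omega_d_eta Z.act2_Dq_omega Z.orthogonal_splitting Z.V_D Z.D_block Z.commutator_J_Dq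
        Z.derivation_Dq Z.sym_skew_commutator; assumption?)+
qed

end
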